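(* Let $E$ be a complex Hilbert space, let $f\in\mathcal{B}(B_E)$ and $x,y\in B_E$. Then $$\bigl|(1-\|x\|^2)\,\mathcal{R}f(x)-(1-\|y\|^2)\,\mathcal{R}f(y)\bigr|\le 14\,\|f\|_{\mathcal{I}}\;\rho_E(x,y).$$
   Context: $E$ is a finite or infinite dimensional complex Hilbert space (inner product linear in the first variable), $B_E$ its open unit ball. The pseudohyperbolic distance $\rho_E(x,y)\in[0,1)$ on $B_E$ is given by $\rho_E(x,y)^2=1-\frac{(1-\|x\|^2)(1-\|y\|^2)}{|1-\langle x,y\rangle|^2}$. For holomorphic (Fréchet differentiable) $f:B_E\to\mathbb{C}$, $\nabla f(x)$ denotes the derivative $f'(x)$, and $\mathcal{R}f(x)=\langle x,\overline{\nabla f(x)}\rangle=f'(x)(x)$ is the radial derivative. The Bloch space $\mathcal{B}(B_E)$ is the set of holomorphic $f:B_E\to\mathbb{C}$ with $\sup_{x\in B_E}(1-\|x\|^2)\|\nabla f(x)\|<\infty$. For $x\in B_E$, let $\varphi_x:B_E\to B_E$ be the automorphism $\varphi_x(y)=(s_xQ_x+P_x)\left(\frac{x-y}{1-\langle y,x\rangle}\right)$, where $s_x=\sqrt{1-\|x\|^2}$, $P_x(y)=\frac{\langle y,x\rangle}{\langle x,x\rangle}x$ is the orthogonal projection onto the span of $x$, $Q_x=\mathrm{Id}_E-P_x$, and $P_0=0$ (so $\varphi_0(y)=-y$). The invariant gradient is $\widetilde\nabla f(x)=\nabla(f\circ\varphi_x)(0)$ and $\|f\|_{\mathcal{I}}=\sup_{x\in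 B_E}\|\widetilde\nabla f(x)\|$, which is finite for $f\in\mathcal{B}(B_E)$. *)

theory Defs
  imports "HOL-Analysis.Analysis"
begin

text \<open>
  Complex Hilbert spaces of arbitrary dimension: a Banach space whose real scalar multiplication
  extends to a complex one and whose norm comes from an inner product that is linear in the first
  variable. Positive definiteness of the inner product follows from \<open>cinner_self\<close>.
\<close>

class complex_hilbert_space = banach +
  fixes scaleC :: "complex \<Rightarrow> 'a \<Rightarrow> 'a"  (infixr \<open>*\<^sub>C\<close> 75)
    and cinner :: "'a \<Rightarrow> 'a \<Rightarrow> complex"
  assumes scaleC_add_right: "a *\<^sub>C (x + y) = a *\<^sub>C x + a *\<^sub>C y"
    and scaleC_add_left: "(a + b) *\<^sub>C x = a *\<^sub>C x + b *\<^sub>C x"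
    and scaleC_scaleC: "a *\<^sub>C b *\<^sub>C x = (a * b) *\<^sub>C x"
    and scaleC_of_real: "complex_of_real r *\<^sub>C x = r *\<^sub>R x"
    and cinner_commute: "cinner x y = cnj (cinner y x)"
    and cinner_add_left: "cinner (x + y) z = cinner x z + cinner y z"
    and cinner_scaleC_left: "cinner (a *\<^sub>C x) y = a * cinner x y"
    and cinner_self: "cinner x x = complex_of_real ((norm x)\<^sup>2)"

instantiation complex :: complex_hilbert_space
begin

definition scaleC_complex :: "complex \<Rightarrow> complex \<Rightarrow> complex"
  where "scaleC_complex a x = a * x"

definition cinner_complex :: "complex \<Rightarrow> complex \<Rightarrow> complex"
  where "cinner_complex x y = x * cnj y"

instance
  by standard
    (simp_all add: scaleC_complex_def cinner_complex_def algebra_simps scaleR_conv_of_real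
      complex_norm_square[symmetric])

end

definition pseudohyperbolic :: "'a::complex_hilbert_space \<Rightarrow> 'a \<Rightarrow> real"
  where "pseudohyperbolic x y =
    sqrt (1 - (1 - (norm x)\<^sup>2) * (1 - (norm y)\<^sup>2) / (cmod (1 - cinner x y))\<^sup>2)"

text \<open>
  Functions on the ball are total functions of which only the values on the ball matter. The
  derivative \<open>has_derivative\<close> is the real Frechet derivative, so complex linearity is required
  separately; boundedness is already part of \<open>has_derivative\<close>.
\<close>

definition frechet_holomorphic_on ::
    "('a::complex_hilbert_space \<Rightarrow> complex) \<Rightarrow> 'a set \<Rightarrow> bool"
  where "frechet_holomorphic_on f S \<longleftrightarrow>
    (\<forall>x\<in>S. \<exists>D. (f has_derivative D) (at x) \<and> (\<forall>c v. D (c *\<^sub>C v) = c * D v))"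

abbreviation nabla :: "('a::complex_hilbert_space \<Rightarrow> complex) \<Rightarrow> 'a \<Rightarrow> 'a \<Rightarrow> complex"
  where "nabla f x \<equiv> frechet_derivative f (at x)"

definition radial_derivative :: "('a::complex_hilbert_space \<Rightarrow> complex) \<Rightarrow> 'a \<Rightarrow> complex"
  where "radial_derivative f x = nabla f x x"

definition bloch_space :: "('a::complex_hilbert_space \<Rightarrow> complex) set"
  where "bloch_space = {f. frechet_holomorphic_on f (ball 0 1) \<and>
    bdd_above ((\<lambda>x. (1 - (norm x)\<^sup>2) * onorm (nabla f x)) ` ball 0 1)}"

text \<open>For \<open>x = 0\<close> this is the zero map.\<close>

definition span_proj :: "'a::complex_hilbert_space \<Rightarrow> 'a \<Rightarrow> 'a"
  where "span_proj x y = (cinner y x / cinner x x) *\<^sub>C x"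

definition ball_automorphism :: "'a::complex_hilbert_space \<Rightarrow> 'a \<Rightarrow> 'a"
  where "ball_automorphism x y =
    (let w = (1 / (1 - cinner y x)) *\<^sub>C (x - y)
     in sqrt (1 - (norm x)\<^sup>2) *\<^sub>R (w - span_proj x w) + span_proj x w)"

definition invariant_gradient ::
    "('a::complex_hilbert_space \<Rightarrow> complex) \<Rightarrow> 'a \<Rightarrow> 'a \<Rightarrow> complex"
  where "invariant_gradient f x = nabla (f \<circ> ball_automorphism x) 0"

text \<open>
  A supremum of reals, meaningful because the set is bounded above for every \<open>f\<close> in the Bloch
  space.
\<close>

definition invariant_norm :: "('a::complex_hilbert_space \<Rightarrow> complex) \<Rightarrow> real"
  where "invariant_norm f = (SUP x\<in>ball 0 1. onorm (invariant_gradient f x))"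

end

theory Submission
  imports Defs "HOL-Complex_Analysis.Cauchy_Integral_Formula"
begin

text \<open>
  The inequality is one about a single function, the radial derivative \<open>R f\<close>, on a single complex
  disc.

  Since \<open>x\<close> is an eigenvector of the derivative of the automorphism at the origin, the invariant
  gradient at \<open>x\<close> takes the value \<open>- (1 - \<parallel>x\<parallel>\<^sup>2) R f(x)\<close> on \<open>x\<close>. Hence \<open>(1 - \<parallel>x\<parallel>\<^sup>2) |R f(x)| \<le> M\<close> on
  the ball, where \<open>M\<close> is the invariant norm of \<open>f\<close>
  (\<open>weighted_radial_derivative_le_invariant_norm\<close>). This and the holomorphy of \<open>R f\<close> along complex
  lines are all that is used of \<open>f\<close> from then on.

  The complex line through two points \<open>x \<noteq> y\<close> is \<open>c + z e\<close> with \<open>c\<close> its point nearest to the origin, and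
  it meets the ball in an affine disc. When \<open>e\<close> is scaled to make \<open>z\<close> range over the unit disc,
  \<open>1 - \<parallel>c + z e\<parallel>\<^sup>2 = (1 - \<parallel>c\<parallel>\<^sup>2) (1 - |z|\<^sup>2)\<close>, and the pseudohyperbolic distance of the ball restricts to
  that of the disc (\<open>pseudohyperbolic_orthogonal_disc\<close>). So \<open>H(z) = (1 - \<parallel>c\<parallel>\<^sup>2) R f(c + z e)\<close> is
  holomorphic with \<open>(1 - |z|\<^sup>2) |H(z)| \<le> M\<close>, and the theorem becomes a statement about such \<open>H\<close>, which
  is \<open>weighted_difference_le_disc_distance\<close>: a disc automorphism moves one of the two points to the
  origin, where Cauchy's estimate applies if the points are close; if they are at distance at least
  \<open>1/7\<close>, the trivial bound \<open>2 M\<close> suffices.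

  Two facts from function theory are needed on the way. The derivative of \<open>f\<close> in a fixed direction is
  holomorphic along complex lines, although \<open>f\<close> is only assumed Frechet differentiable
  (\<open>nabla_holomorphic_along_complex_line\<close>). And the supremum defining \<open>M\<close> is finite for Bloch
  functions (\<open>invariant_gradient_bdd_above\<close>): the Bloch condition controls the derivative with the
  weight \<open>1 - \<parallel>x\<parallel>\<^sup>2\<close>, but in directions orthogonal to \<open>x\<close> the invariant gradient only carries the weight
  \<open>sqrt (1 - \<parallel>x\<parallel>\<^sup>2)\<close>.
\<close>

section \<open>Complex inner product spaces\<close>

lemma norm_scaleC: "norm (c *\<^sub>C x) = cmod c * norm (x :: 'a::complex_hilbert_space)"
proof -
  have "complex_of_real ((norm (c *\<^sub>C x))\<^sup>2) = c * cnj (c * cnj (cinner x x))"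
    by (metis cinner_commute cinner_scaleC_left cinner_self)
  also have "\<dots> = complex_of_real ((cmod c * norm x)\<^sup>2)"
    using complex_norm_square[of c]
    by (simp add: cinner_self power_mult_distrib)
  finally have "(norm (c *\<^sub>C x))\<^sup>2 = (cmod c * norm x)\<^sup>2"
    by (simp only: of_real_eq_iff)
  then show ?thesis
    by (simp add: power2_eq_iff_nonneg)
qed

lemma cinner_scaleC_right: "cinner x (c *\<^sub>C y) = cnj c * cinner (x :: 'a::complex_hilbert_space) y"
  by (metis cinner_commute cinner_scaleC_left complex_cnj_mult)

lemma cinner_add_right: "cinner x (y + z) = cinner x y + cinner (x :: 'a::complex_hilbert_space) z"
  by (metis cinner_commute cinner_add_left complex_cnj_add)

lemma cinner_zero_left [simp]: "cinner 0 (x :: 'a::complex_hilbert_space) = 0"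
  using cinner_add_left[of 0 0 x] by simp

lemma cinner_zero_right [simp]: "cinner (x :: 'a::complex_hilbert_space) 0 = 0"
  using cinner_add_right[of x 0 0] by simp

lemma cinner_diff_left: "cinner (x - y) z = cinner x z - cinner (y :: 'a::complex_hilbert_space) z"
  using cinner_add_left[of "x - y" y z] by simp

lemma norm_add_orthogonal:
  fixes x y :: "'a::complex_hilbert_space"
  assumes "cinner x y = 0"
  shows "(norm (x + y))\<^sup>2 = (norm x)\<^sup>2 + (norm y)\<^sup>2"
proof -
  have "cinner y x = 0"
    by (metis assms cinner_commute complex_cnj_zero)
  then have "cinner (x + y) (x + y) = cinner x x + cinner y y"
    by (simp add: cinner_add_left cinner_add_right assms)
  then show ?thesis
    unfolding cinner_self by (metis of_real_add of_real_eq_iff)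
qed

lemma cinner_minus_span_proj: "cinner (y - span_proj x y) (x :: 'a::complex_hilbert_space) = 0"
  by (cases "x = 0")
     (simp_all add: span_proj_def cinner_diff_left cinner_scaleC_left cinner_self)

lemma norm_span_proj_decomposition:
  "(norm y)\<^sup>2 = (norm (y - span_proj x y))\<^sup>2 + (norm (span_proj x (y :: 'a::complex_hilbert_space)))\<^sup>2"
proof -
  have "cinner (y - span_proj x y) (span_proj x y) = 0"
    using cinner_minus_span_proj[of y x]
    by (simp add: span_proj_def cinner_scaleC_right)
  from norm_add_orthogonal[OF this] show ?thesis by simp
qed

lemma norm_span_proj_le: "norm (span_proj x y) \<le> norm (y :: 'a::complex_hilbert_space)"
  by (rule power2_le_imp_le) (use norm_span_proj_decomposition[of y x] in auto)

lemma norm_minus_span_proj_le: "norm (y - span_proj x y) \<le> norm (y :: 'a::complex_hilbert_space)"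
  by (rule power2_le_imp_le) (use norm_span_proj_decomposition[of y x] in auto)

lemma norm_cinner_le: "cmod (cinner x y) \<le> norm x * norm (y :: 'a::complex_hilbert_space)"
proof (cases "y = 0")
  case False
  have "cmod (cinner x y) / norm y \<le> norm x"
    using norm_span_proj_le[of y x] False
    by (simp add: span_proj_def norm_scaleC cinner_self norm_divide norm_power)
       (simp add: power2_eq_square)
  then show ?thesis
    using False by (simp add: field_simps)
qed simp

lemma bounded_bilinear_scaleC:
  "bounded_bilinear (scaleC :: complex \<Rightarrow> 'a \<Rightarrow> 'a::complex_hilbert_space)"
proof (rule bounded_bilinear.intro)
  show "\<exists>K. \<forall>a b. norm (a *\<^sub>C (b::'a)) \<le> norm a * norm b * K"
    by (rule exI[of _ 1]) (simp add: norm_scaleC)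
  fix r c and x :: 'a
  show "(r *\<^sub>R c) *\<^sub>C x = r *\<^sub>R c *\<^sub>C x"
    by (simp add: scaleR_conv_of_real scaleC_scaleC flip: scaleC_of_real)
  show "c *\<^sub>C (r *\<^sub>R x) = r *\<^sub>R c *\<^sub>C x"
    by (simp add: scaleC_scaleC mult.commute flip: scaleC_of_real)
qed (simp_all add: scaleC_add_left scaleC_add_right)

lemmas scaleC_algebra = bounded_bilinear.zero_left[OF bounded_bilinear_scaleC]
  bounded_bilinear.zero_right[OF bounded_bilinear_scaleC]
  bounded_bilinear.minus_left[OF bounded_bilinear_scaleC]
  bounded_bilinear.minus_right[OF bounded_bilinear_scaleC]
  bounded_bilinear.diff_left[OF bounded_bilinear_scaleC]
  bounded_bilinear.diff_right[OF bounded_bilinear_scaleC]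
  scaleC_add_left scaleC_add_right scaleC_scaleC

lemma scaleC_one [simp]: "1 *\<^sub>C x = (x :: 'a::complex_hilbert_space)"
  using scaleC_of_real[of 1 x] by simp

lemma bounded_bilinear_cinner:
  "bounded_bilinear (cinner :: 'a \<Rightarrow> 'a::complex_hilbert_space \<Rightarrow> complex)"
proof (rule bounded_bilinear.intro)
  show "\<exists>K. \<forall>a b. norm (cinner a (b::'a)) \<le> norm a * norm b * K"
    by (rule exI[of _ 1]) (simp add: norm_cinner_le)
  fix r and x y :: 'a
  show "cinner (r *\<^sub>R x) y = r *\<^sub>R cinner x y" "cinner x (r *\<^sub>R y) = r *\<^sub>R cinner x y"
    by (simp_all add: cinner_scaleC_left cinner_scaleC_right scaleR_conv_of_real flip: scaleC_of_real)
qed (simp_all add: cinner_add_left cinner_add_right)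

lemma bounded_linear_cinner_left:
  "bounded_linear (\<lambda>x. cinner x (y :: 'a::complex_hilbert_space))"
  by (rule bounded_bilinear.bounded_linear_left[OF bounded_bilinear_cinner])

lemma bounded_linear_span_proj: "bounded_linear (span_proj (x :: 'a::complex_hilbert_space))"
proof -
  have "bounded_linear (\<lambda>y. (cinner y x * inverse (cinner x x)) *\<^sub>C x)"
    by (intro bounded_linear_compose[OF bounded_bilinear.bounded_linear_left[OF bounded_bilinear_scaleC]]
        bounded_linear_compose[OF bounded_linear_mult_left] bounded_linear_cinner_left)
  then show ?thesis
    by (simp add: span_proj_def[abs_def] divide_inverse)
qed

section \<open>Derivatives along complex lines\<close>

lemma frechet_holomorphic_has_derivative:
  assumes "frechet_holomorphic_on f S" "x \<in> S"
  shows "(f has_derivative nabla f x) (at x)"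
  using assms frechet_derivative_at unfolding frechet_holomorphic_on_def by blast

lemma nabla_scaleC:
  assumes "frechet_holomorphic_on f S" "x \<in> S"
  shows "nabla f x (c *\<^sub>C v) = c * nabla f x v"
  using assms frechet_derivative_at unfolding frechet_holomorphic_on_def by metis

lemma bounded_linear_nabla:
  assumes "frechet_holomorphic_on f S" "x \<in> S"
  shows "bounded_linear (nabla f x)"
  using frechet_holomorphic_has_derivative[OF assms] has_derivative_bounded_linear by blast

lemma complex_line_has_derivative:
  "((\<lambda>z. p + z *\<^sub>C (v :: 'a::complex_hilbert_space)) has_derivative (\<lambda>h. h *\<^sub>C v)) (at z)"
  by (auto intro!: derivative_eq_intros bounded_linear.has_derivative
      [OF bounded_bilinear.bounded_linear_left[OF bounded_bilinear_scaleC]])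

lemma has_field_derivative_along_complex_line:
  assumes "frechet_holomorphic_on f S" "p + z *\<^sub>C v \<in> S"
  shows "((\<lambda>z. f (p + z *\<^sub>C v)) has_field_derivative nabla f (p + z *\<^sub>C v) v) (at z)"
proof -
  have "((\<lambda>z. f (p + z *\<^sub>C v)) has_derivative (\<lambda>h. nabla f (p + z *\<^sub>C v) (h *\<^sub>C v))) (at z)"
    using has_derivative_compose[OF complex_line_has_derivative
        frechet_holomorphic_has_derivative[OF assms]] by simp
  then show ?thesis
    by (simp add: has_field_derivative_def nabla_scaleC[OF assms] mult_commute_abs)
qed

text \<open>
  Cauchy's inequality for the first derivative, with the bound taken on the whole closed disc.
\<close>

lemma norm_deriv_le_Cauchy:
  assumes "f holomorphic_on S" "open S" "cball z r \<subseteq> S" "0 < r"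
    and "\<And>w. w \<in> cball z r \<Longrightarrow> cmod (f w) \<le> B"
  shows "cmod (deriv f z) \<le> B / r"
proof -
  have "cmod ((deriv ^^ 1) f z) \<le> fact 1 * B / r ^ 1"
  proof (rule Cauchy_inequality)
    show "f holomorphic_on ball z r" "continuous_on (cball z r) f"
      using assms(1,3) ball_subset_cball
      by (meson holomorphic_on_subset holomorphic_on_imp_continuous_on order_trans)+
  qed (use assms in \<open>auto simp: dist_norm\<close>)
  then show ?thesis by simp
qed

text \<open>
  What matters is that the error depends on \<open>f\<close> only through its supremum, so that the difference
  quotients of a locally bounded family of functions converge uniformly over the family. The constant
  comes from Cauchy's inequality for the second derivative on discs of radius \<open>k/4\<close> around points of
  modulus at most \<open>k/2\<close>.
\<close>

lemma difference_quotient_bound: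
  assumes "f holomorphic_on ball 0 k" "\<And>w. w \<in> ball 0 k \<Longrightarrow> cmod (f w) \<le> B"
    and h: "h \<noteq> 0" "cmod h \<le> k / 2"
  shows "cmod ((f h - f 0) / h - deriv f 0) \<le> 32 * B / k\<^sup>2 * cmod h"
proof -
  have "0 < cmod h" using h by simp
  then have k: "0 < k" using h(2) by linarith
  have B: "cmod (deriv (deriv f) z) \<le> 32 * B / k\<^sup>2" if z: "z \<in> cball 0 (k / 2)" for z
  proof -
    have sub: "cball z (k / 4) \<subseteq> ball 0 k"
    proof
      fix w assume "w \<in> cball z (k / 4)"
      then show "w \<in> ball 0 k"
        using z k dist_triangle[of 0 w z] by auto
    qed
    have "cmod ((deriv ^^ 2) f z) \<le> fact 2 * B / (k / 4) ^ 2"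
    proof (rule Cauchy_inequality)
      show "f holomorphic_on ball z (k / 4)" "continuous_on (cball z (k / 4)) f"
        using assms(1) sub ball_subset_cball
        by (meson holomorphic_on_subset holomorphic_on_imp_continuous_on order_trans)+
      show "cmod (f w) \<le> B" if "cmod (z - w) = k / 4" for w
        using that sub by (intro assms(2)) (auto simp: dist_norm)
    qed (use k in auto)
    then show ?thesis by (simp add: power_divide numeral_2_eq_2)
  qed
  have "cmod ((deriv ^^ 0) f h - (\<Sum>i\<le>1. (deriv ^^ i) f 0 * (h - 0) ^ i / fact i))
      \<le> 32 * B / k\<^sup>2 * cmod (h - 0) ^ Suc 1 / fact 1"
  proof (rule complex_Taylor[of "cball 0 (k/2)"])
    show "((deriv ^^ i) f has_field_derivative (deriv ^^ Suc i) f z) (at z within cball 0 (k / 2))"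
      if "z \<in> cball 0 (k / 2)" for i z
      by (rule has_field_derivative_at_within, rule has_field_derivative_higher_deriv[OF assms(1) open_ball])
         (use that k in simp)
    show "cmod ((deriv ^^ Suc 1) f z) \<le> 32 * B / k\<^sup>2" if "z \<in> cball 0 (k / 2)" for z
      using B[OF that] by simp
  qed (use h k in simp_all)
  then have "cmod (f h - f 0 - deriv f 0 * h) \<le> 32 * B / k\<^sup>2 * (cmod h)\<^sup>2"
    by (simp add: power2_eq_square algebra_simps)
  moreover have "(f h - f 0) / h - deriv f 0 = (f h - f 0 - deriv f 0 * h) / h"
    using h by (simp add: field_simps)
  ultimately show ?thesis
    using h by (simp add: norm_divide field_simps power2_eq_square)
qed

text \<open>
  The difference quotients of \<open>f\<close> in direction \<open>v\<close> are holomorphic in \<open>z\<close>. As \<open>f\<close> is continuous, it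
  is bounded near each point, so by the previous lemma these quotients converge to the derivative
  locally uniformly in \<open>z\<close>.
\<close>

lemma nabla_holomorphic_along_complex_line:
  fixes f :: "'a::complex_hilbert_space \<Rightarrow> complex"
  assumes f: "frechet_holomorphic_on f S" and "open S" "open A"
    and line: "\<And>z. z \<in> A \<Longrightarrow> p + z *\<^sub>C e \<in> S"
  shows "(\<lambda>z. nabla f (p + z *\<^sub>C e) v) holomorphic_on A"
  unfolding holomorphic_on_open[OF \<open>open A\<close>]
proof
  fix z0 assume "z0 \<in> A"
  define q where "q = p + z0 *\<^sub>C e"
  have q: "q \<in> S" using line[OF \<open>z0 \<in> A\<close>] by (simp add: q_def)
  have "isCont f q"
    using frechet_holomorphic_has_derivative[OF f q] has_derivative_continuous by blast
  then obtain d1 where d1: "d1 > 0" "\<And>x. dist x q < d1 \<Longrightarrow> dist (f x) (f q) < 1"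
    unfolding continuous_at_eps_delta by (metis zero_less_one)
  obtain d2 where d2: "d2 > 0" "ball q d2 \<subseteq> S"
    using \<open>open S\<close> q openE by blast
  define B where "B = cmod (f q) + 1"
  \<comment> \<open>For \<open>|z - z0| < k\<close> and \<open>|w| < k\<close> the point \<open>p + z e + w v\<close> stays in the neighbourhood of \<open>q\<close>
    on which \<open>f\<close> is defined and bounded by \<open>B\<close>.\<close>
  define k where "k = min d1 d2 / (norm e + norm v + 1)"
  have k: "k > 0" using d1 d2 by (simp add: k_def add_nonneg_pos)
  have near: "p + z *\<^sub>C e + w *\<^sub>C v \<in> S \<and> cmod (f (p + z *\<^sub>C e + w *\<^sub>C v)) \<le> B"
    if "z \<in> ball z0 k" "w \<in> ball 0 k" for z w
  proof -
    have "p + z *\<^sub>C e + w *\<^sub>C v - q = (z - z0) *\<^sub>C e + w *\<^sub>C v"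
      by (simp add: q_def scaleC_algebra)
    then have "norm (p + z *\<^sub>C e + w *\<^sub>C v - q) \<le> cmod (z - z0) * norm e + cmod w * norm v"
      by (metis norm_triangle_ineq norm_scaleC)
    also have "\<dots> \<le> k * norm e + k * norm v"
      using that by (intro add_mono mult_right_mono) (auto simp: dist_norm norm_minus_commute)
    also have "\<dots> < k * (norm e + norm v + 1)"
      using k by (simp add: algebra_simps)
    also have "\<dots> = min d1 d2"
      by (simp add: k_def add_nonneg_eq_0_iff add_nonneg_pos less_imp_neq[symmetric])
    finally have *: "dist (p + z *\<^sub>C e + w *\<^sub>C v) q < min d1 d2"
      by (simp add: dist_norm)
    then have "dist (f (p + z *\<^sub>C e + w *\<^sub>C v)) (f q) < 1"
      using d1 by auto
    then have "cmod (f (p + z *\<^sub>C e + w *\<^sub>C v)) \<le> B"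
      unfolding B_def dist_norm by (smt (verit) norm_triangle_ineq2)
    moreover have "p + z *\<^sub>C e + w *\<^sub>C v \<in> S"
      using * d2 by (auto simp: dist_commute)
    ultimately show ?thesis by simp
  qed
  define h where "h n = complex_of_real (k / 2 / real (Suc n))" for n
  have h: "h n \<noteq> 0" "cmod (h n) \<le> k / 2" "h n \<in> ball 0 k" for n
  proof -
    have "cmod (h n) = k / 2 / real (Suc n)"
      using k unfolding h_def by (simp only: norm_of_real) simp
    also have "\<dots> \<le> k / 2"
      using k by (simp add: field_simps)
    finally show *: "cmod (h n) \<le> k / 2" .
    then show "h n \<in> ball 0 k"
      using k by (simp add: dist_norm)
    show "h n \<noteq> 0"
      using k by (simp add: h_def del: of_nat_Suc)
  qed
  define G where "G n z = (f (p + z *\<^sub>C e + h n *\<^sub>C v) - f (p + z *\<^sub>C e)) / h n" for n z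
  have "(\<lambda>z. nabla f (p + z *\<^sub>C e) v) holomorphic_on ball z0 k"
  proof (rule holomorphic_uniform_sequence[where f = G])
    fix n
    have 1: "(\<lambda>z. f (p + w *\<^sub>C v + z *\<^sub>C e)) holomorphic_on ball z0 k" if "w \<in> ball 0 k" for w
      unfolding holomorphic_on_open[OF open_ball]
    proof
      fix z assume "z \<in> ball z0 k"
      with near[OF this that] have "p + w *\<^sub>C v + z *\<^sub>C e \<in> S" by (simp add: add_ac)
      from has_field_derivative_along_complex_line[OF f this]
      show "\<exists>d. ((\<lambda>z. f (p + w *\<^sub>C v + z *\<^sub>C e)) has_field_derivative d) (at z)" by blast
    qed
    show "G n holomorphic_on ball z0 k"
      unfolding G_def using 1[OF h(3)[of n]] 1[of 0] k h
      by (intro holomorphic_intros) (auto simp: scaleC_algebra add_ac)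
  next
    have bound: "cmod (G n z - nabla f (p + z *\<^sub>C e) v) \<le> 32 * B / k\<^sup>2 * cmod (h n)"
      if z: "z \<in> ball z0 k" for n z
    proof -
      let ?F = "\<lambda>w. f (p + z *\<^sub>C e + w *\<^sub>C v)"
      have d: "(?F has_field_derivative nabla f (p + z *\<^sub>C e + w *\<^sub>C v) v) (at w)"
        if "w \<in> ball 0 k" for w
        using near[OF z that] by (intro has_field_derivative_along_complex_line[OF f]) auto
      then have "?F holomorphic_on ball 0 k"
        unfolding holomorphic_on_open[OF open_ball] by blast
      from difference_quotient_bound[OF this _ h(1,2), of B n]
      have "cmod ((?F (h n) - ?F 0) / h n - deriv ?F 0) \<le> 32 * B / k\<^sup>2 * cmod (h n)"
        using near[OF z] by auto
      moreover have "deriv ?F 0 = nabla f (p + z *\<^sub>C e) v"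
        using DERIV_imp_deriv[OF d[of 0]] k by (simp add: scaleC_algebra)
      ultimately show ?thesis
        by (simp add: G_def scaleC_algebra)
    qed
    have lim: "(\<lambda>n. 32 * B / k\<^sup>2 * cmod (h n)) \<longlonglongrightarrow> 0"
    proof -
      have "(\<lambda>n. 32 * B / k\<^sup>2 * cmod (complex_of_real (k / 2 * inverse (real (Suc n))))) \<longlonglongrightarrow>
          32 * B / k\<^sup>2 * cmod (complex_of_real (k / 2 * 0))"
        by (intro tendsto_intros LIMSEQ_inverse_real_of_nat)
      then show ?thesis
        by (simp only: h_def divide_inverse mult_zero_right of_real_0 norm_zero)
    qed
    fix z assume "z \<in> ball z0 k"
    then obtain r where r: "r > 0" "cball z r \<subseteq> ball z0 k"
      using open_contains_cball open_ball by blast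
    have "uniform_limit (cball z r) G (\<lambda>z. nabla f (p + z *\<^sub>C e) v) sequentially"
    proof (rule uniform_limitI)
      fix \<epsilon> :: real assume "\<epsilon> > 0"
      then have "\<forall>\<^sub>F n in sequentially. 32 * B / k\<^sup>2 * cmod (h n) < \<epsilon>"
        using order_tendstoD(2)[OF lim] by blast
      then show "\<forall>\<^sub>F n in sequentially. \<forall>x\<in>cball z r. dist (G n x) (nabla f (p + x *\<^sub>C e) v) < \<epsilon>"
      proof eventually_elim
        case (elim n)
        show ?case
        proof
          fix x assume "x \<in> cball z r"
          with r have "x \<in> ball z0 k" by blast
          from le_less_trans[OF bound[OF this] elim]
          show "dist (G n x) (nabla f (p + x *\<^sub>C e) v) < \<epsilon>"
            by (simp only: dist_norm)
        qed
      qed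
    qed
    with r show "\<exists>d>0. cball z d \<subseteq> ball z0 k \<and>
        uniform_limit (cball z d) G (\<lambda>z. nabla f (p + z *\<^sub>C e) v) sequentially"
      by blast
  qed simp
  then show "\<exists>f'. ((\<lambda>z. nabla f (p + z *\<^sub>C e) v) has_field_derivative f') (at z0)"
    using k by (meson centre_in_ball holomorphic_on_open open_ball)
qed

section \<open>Weighted functions on the unit disc\<close>

lemma disc_automorphism_identity:
  "(cmod (1 - cnj a * z))\<^sup>2 - (cmod (a - z))\<^sup>2 = (1 - (cmod a)\<^sup>2) * (1 - (cmod z)\<^sup>2)"
  unfolding cmod_power2 by (simp add: power2_eq_square algebra_simps)

lemma one_minus_cnj_mult_nonzero:
  assumes "cmod a < 1" "cmod z < 1"
  shows "1 - cnj a * z \<noteq> 0"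
proof
  assume "1 - cnj a * z = 0"
  then have "cmod a * cmod z = 1"
    by (metis complex_mod_cnj eq_iff_diff_eq_0 norm_mult norm_one)
  then show False
    using assms mult_strict_mono[of "cmod a" 1 "cmod z" 1] by auto
qed

lemma one_minus_norm_disc_automorphism:
  assumes "cmod a < 1" "cmod z < 1"
  shows "1 - (cmod ((a - z) / (1 - cnj a * z)))\<^sup>2
    = (1 - (cmod a)\<^sup>2) * (1 - (cmod z)\<^sup>2) / (cmod (1 - cnj a * z))\<^sup>2"
proof -
  have "1 - (cmod ((a - z) / (1 - cnj a * z)))\<^sup>2
      = ((cmod (1 - cnj a * z))\<^sup>2 - (cmod (a - z))\<^sup>2) / (cmod (1 - cnj a * z))\<^sup>2"
    using one_minus_cnj_mult_nonzero[OF assms]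
    by (simp only: norm_divide power_divide diff_divide_distrib[of "_\<^sup>2"]) simp
  then show ?thesis
    by (simp only: disc_automorphism_identity)
qed

lemma norm_disc_automorphism_less_1:
  assumes "cmod a < 1" "cmod z < 1"
  shows "cmod ((a - z) / (1 - cnj a * z)) < 1"
proof -
  have "0 < (1 - (cmod a)\<^sup>2) * (1 - (cmod z)\<^sup>2) / (cmod (1 - cnj a * z))\<^sup>2"
    using assms one_minus_cnj_mult_nonzero[OF assms] by (simp add: power_less_one_iff abs_square_less_1)
  then have "(cmod ((a - z) / (1 - cnj a * z)))\<^sup>2 < 1"
    using one_minus_norm_disc_automorphism[OF assms] by linarith
  then show ?thesis
    by (simp add: abs_square_less_1)
qed

text \<open>
  On \<open>|z| \<le> 9/14\<close> the weight is at least \<open>1/2\<close>, so \<open>K\<close> is bounded by \<open>2 M\<close> there; discs of radius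
  \<open>1/2\<close> around the points of \<open>|z| \<le> 1/7\<close> stay in this region, and Cauchy's inequality bounds the
  derivative of \<open>K\<close> by \<open>4 M\<close>.
\<close>

lemma weighted_increment_at_origin:
  assumes hol: "K holomorphic_on ball 0 1"
    and bd: "\<And>z. cmod z < 1 \<Longrightarrow> (1 - (cmod z)\<^sup>2) * cmod (K z) \<le> M"
    and w: "cmod w \<le> 1 / 7"
  shows "cmod (K w - K 0) \<le> 4 * M * cmod w"
proof (rule order_trans[OF field_differentiable_bound[of "cball 0 (1/7)" K "deriv K" "4 * M" w 0]])
  have K: "cmod (K z) \<le> 2 * M" if "cmod z \<le> 9 / 14" for z
  proof -
    have "(cmod z)\<^sup>2 \<le> (9 / 14)\<^sup>2"
      using that by (intro power_mono) auto
    then have "1 / 2 * cmod (K z) \<le> (1 - (cmod z)\<^sup>2) * cmod (K z)"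
      by (intro mult_right_mono) (auto simp: power2_eq_square)
    also have "\<dots> \<le> M" using that by (intro bd) auto
    finally show ?thesis by simp
  qed
  show "(K has_field_derivative deriv K z) (at z within cball 0 (1/7))"
    if "z \<in> cball 0 (1/7)" for z
    by (rule has_field_derivative_at_within, rule holomorphic_derivI[OF hol open_ball])
       (use that in simp)
  show "cmod (deriv K z) \<le> 4 * M" if z: "z \<in> cball 0 (1/7)" for z
  proof -
    have near: "cmod u \<le> 9 / 14" if "u \<in> cball z (1 / 2)" for u
      using that z dist_triangle[of 0 u z] by auto
    have "cmod (deriv K z) \<le> 2 * M / (1 / 2)"
      using near by (intro norm_deriv_le_Cauchy[OF hol] K) fastforce+
    then show ?thesis by simp
  qed
qed (use w in auto)

text \<open>
  Let \<open>\<phi>(z) = (a - z) / (1 - cnj a z)\<close> be the automorphism exchanging \<open>0\<close> and \<open>a\<close>, and \<open>w = \<phi>(b)\<close>, so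
  that \<open>\<phi>(w) = b\<close> and \<open>|w|\<close> is the distance of \<open>a\<close> and \<open>b\<close>. Up to sign, \<open>K(z) = H(\<phi>(z)) \<phi>'(z)\<close>
  satisfies the same weighted bound as \<open>H\<close>. The weighted value of \<open>H\<close> at \<open>a\<close> is \<open>K(0)\<close>, and at
  \<open>b\<close> it is \<open>(1 - |w|\<^sup>2) u K(w)\<close> with a unimodular factor \<open>u\<close>, up to sign the phase of \<open>1 / \<phi>'(w)\<close>,
  that differs from \<open>1\<close> by at most a multiple of \<open>|w|\<close>. It remains to compare \<open>K(w)\<close> with \<open>K(0)\<close>.
\<close>

lemma weighted_difference_le_disc_distance:
  assumes hol: "H holomorphic_on ball 0 1"
    and bd: "\<And>z. cmod z < 1 \<Longrightarrow> (1 - (cmod z)\<^sup>2) * cmod (H z) \<le> M"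
    and a: "cmod a < 1" and b: "cmod b < 1"
  shows "cmod (of_real (1 - (cmod a)\<^sup>2) * H a - of_real (1 - (cmod b)\<^sup>2) * H b)
    \<le> 14 * M * cmod ((a - b) / (1 - cnj a * b))"
proof -
  define w where "w = (a - b) / (1 - cnj a * b)"
  define r where "r = cmod w"
  have pos: "0 < 1 - (cmod z)\<^sup>2" if "cmod z < 1" for z
    using that by (simp add: power_less_one_iff abs_square_less_1)
  have w1: "cmod w < 1"
    unfolding w_def by (rule norm_disc_automorphism_less_1[OF a b])
  have M: "0 \<le> M"
    using bd[OF a] pos[OF a] by (smt (verit) mult_nonneg_nonneg norm_ge_zero)
  have wt: "cmod (of_real (1 - (cmod z)\<^sup>2) * H z) \<le> M" if "cmod z < 1" for z
    using bd[OF that] pos[OF that] by (simp only: norm_mult norm_of_real)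
  show ?thesis
  proof (cases "r \<ge> 1 / 7")
    case True
    have "cmod (of_real (1 - (cmod a)\<^sup>2) * H a - of_real (1 - (cmod b)\<^sup>2) * H b) \<le> M + M"
      by (rule order_trans[OF norm_triangle_ineq4 add_mono[OF wt[OF a] wt[OF b]]])
    also have "\<dots> \<le> 14 * M * r"
      using True M mult_left_mono[of "1/7" r "14 * M"] by simp
    finally show ?thesis by (simp add: r_def w_def)
  next
    case False
    define q where "q z = 1 - cnj a * z" for z
    define K where "K z = of_real (1 - (cmod a)\<^sup>2) * H ((a - z) / q z) / (q z)\<^sup>2" for z
    have q: "q z \<noteq> 0" if "cmod z < 1" for z
      unfolding q_def by (rule one_minus_cnj_mult_nonzero[OF a that])
    have K_hol: "K holomorphic_on ball 0 1"
    proof -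
      have "(\<lambda>z. (a - z) / q z) holomorphic_on ball 0 1"
        using q unfolding q_def by (intro holomorphic_intros) auto
      moreover have "(\<lambda>z. (a - z) / q z) ` ball 0 1 \<subseteq> ball 0 1"
        using norm_disc_automorphism_less_1[OF a] by (auto simp: q_def)
      ultimately have "(H \<circ> (\<lambda>z. (a - z) / q z)) holomorphic_on ball 0 1"
        by (rule holomorphic_on_compose_gen[OF _ hol])
      then show ?thesis
        using q unfolding K_def q_def by (intro holomorphic_intros) (auto simp: o_def)
    qed
    have K_bd: "(1 - (cmod z)\<^sup>2) * cmod (K z) \<le> M" if z: "cmod z < 1" for z
    proof -
      have "cmod (K z) = (1 - (cmod a)\<^sup>2) * cmod (H ((a - z) / q z)) / (cmod (q z))\<^sup>2"
        using pos[OF a] unfolding K_def norm_divide norm_mult norm_of_real norm_power by simp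
      then have "(1 - (cmod z)\<^sup>2) * cmod (K z)
          = (1 - (cmod ((a - z) / q z))\<^sup>2) * cmod (H ((a - z) / q z))"
        unfolding q_def one_minus_norm_disc_automorphism[OF a z] by simp
      also have "\<dots> \<le> M"
        unfolding q_def by (intro bd norm_disc_automorphism_less_1 a z)
      finally show ?thesis .
    qed
    have b0: "1 - cnj a * b \<noteq> 0" by (rule one_minus_cnj_mult_nonzero[OF a b])
    have a0: "1 - cnj a * a \<noteq> 0" by (rule one_minus_cnj_mult_nonzero[OF a a])
    have qw: "q w = (1 - cnj a * a) / (1 - cnj a * b)"
      using b0 by (simp add: q_def w_def field_simps)
    have "a - w = b * (1 - cnj a * a) / (1 - cnj a * b)"
      using b0 by (simp add: w_def field_simps)
    then have aw: "(a - w) / q w = b"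
      using a0 b0 by (simp add: qw)
    define u where "u = (q w)\<^sup>2 / of_real ((cmod (q w))\<^sup>2)"
    have K0: "of_real (1 - (cmod a)\<^sup>2) * H a = K 0"
      by (simp add: K_def q_def)
    have Kw: "of_real (1 - (cmod b)\<^sup>2) * H b = of_real (1 - r\<^sup>2) * u * K w"
    proof -
      have "1 - (cmod b)\<^sup>2 = (1 - (cmod a)\<^sup>2) * (1 - r\<^sup>2) / (cmod (q w))\<^sup>2"
        using one_minus_norm_disc_automorphism[OF a w1] aw by (simp add: q_def r_def)
      then show ?thesis
        using q[OF w1] unfolding K_def aw u_def by (simp only: of_real_mult of_real_divide) simp
    qed
    have r: "0 \<le> r" "r \<le> 1 / 7" using False by (auto simp: r_def)
    have r2: "r\<^sup>2 \<le> r / 7"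
      using r mult_left_mono[of r "1/7" r] by (simp add: power2_eq_square)
    have nu: "cmod u = 1"
      using q[OF w1] by (simp add: u_def norm_divide norm_power)
    \<comment> \<open>With \<open>q = q(w)\<close>, \<open>1 - u = (cnj q - q) / cnj q\<close>, and the imaginary part of \<open>q\<close> has modulus at most \<open>r\<close>.\<close>
    have u1: "cmod (1 - u) \<le> 7 / 3 * r"
    proof -
      have "1 - u = q w * (cnj (q w) - q w) / of_real ((cmod (q w))\<^sup>2)"
        using q[OF w1] complex_norm_square[of "q w"]
        by (simp add: u_def field_simps power2_eq_square)
      then have "cmod (1 - u) = cmod (cnj (q w) - q w) / cmod (q w)"
        using q[OF w1] by (simp add: norm_divide norm_mult norm_power power2_eq_square)
      moreover have "cmod (cnj (q w) - q w) \<le> 2 * r"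
      proof -
        have "cmod (cnj (q w) - q w) \<le> cmod (cnj a * w) + cmod (a * cnj w)"
          unfolding q_def by (simp add: norm_triangle_ineq4)
        also have "\<dots> = 2 * (cmod a * r)" by (simp add: norm_mult r_def)
        also have "\<dots> \<le> 2 * r" using a r mult_right_mono[of "cmod a" 1 r] by simp
        finally show ?thesis .
      qed
      moreover have "6 / 7 \<le> cmod (q w)"
      proof -
        have "cmod (cnj a * w) \<le> r"
          using a r mult_right_mono[of "cmod a" 1 r] by (simp add: norm_mult r_def)
        then show ?thesis
          using norm_triangle_ineq2[of 1 "cnj a * w"] r by (simp add: q_def)
      qed
      ultimately have "cmod (1 - u) \<le> 2 * r / (6 / 7)"
        using r by (metis frac_le divide_pos_pos mult_nonneg_nonneg zero_le_numeral zero_less_numeral)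
      then show ?thesis by simp
    qed
    have "cmod (K w) \<le> 7 / 6 * M"
    proof -
      have "6 / 7 * cmod (K w) \<le> (1 - r\<^sup>2) * cmod (K w)"
        using r r2 by (intro mult_right_mono) auto
      also have "\<dots> \<le> M" unfolding r_def by (rule K_bd[OF w1])
      finally show ?thesis by simp
    qed
    moreover have "cmod (1 - of_real (1 - r\<^sup>2) * u) \<le> 3 * r"
    proof -
      have "1 - of_real (1 - r\<^sup>2) * u = (1 - u) + of_real (r\<^sup>2) * u"
        by (simp add: algebra_simps)
      then have "cmod (1 - of_real (1 - r\<^sup>2) * u) \<le> cmod (1 - u) + r\<^sup>2"
        using norm_triangle_ineq[of "1 - u" "of_real (r\<^sup>2) * u"] 
        by (simp only: norm_mult nu norm_of_real abs_power2 mult_1_right)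
      with u1 r2 r show ?thesis by linarith
    qed
    ultimately have "cmod ((1 - of_real (1 - r\<^sup>2) * u) * K w) \<le> 3 * r * (7 / 6 * M)"
      unfolding norm_mult using r by (intro mult_mono) auto
    moreover have "cmod (K w - K 0) \<le> 4 * M * r"
      using weighted_increment_at_origin[OF K_hol K_bd, of w] r by (simp add: r_def)
    moreover have "K 0 - of_real (1 - r\<^sup>2) * u * K w
        = (1 - of_real (1 - r\<^sup>2) * u) * K w - (K w - K 0)"
      by (simp add: algebra_simps)
    then have "cmod (K 0 - of_real (1 - r\<^sup>2) * u * K w)
        \<le> cmod ((1 - of_real (1 - r\<^sup>2) * u) * K w) + cmod (K w - K 0)"
      by (metis norm_triangle_ineq4)
    ultimately have "cmod (K 0 - of_real (1 - r\<^sup>2) * u * K w) \<le> 15 / 2 * (M * r)"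
      by simp
    also have "\<dots> \<le> 14 * (M * r)"
      using M r by (intro mult_right_mono) auto
    finally show ?thesis
      unfolding K0 Kw by (simp add: r_def w_def)
  qed
qed

section \<open>The invariant gradient\<close>

lemma span_proj_scaleC_self: "span_proj x (c *\<^sub>C x) = c *\<^sub>C (x :: 'a::complex_hilbert_space)"
  by (cases "x = 0") (simp_all add: span_proj_def cinner_scaleC_left cinner_self scaleC_algebra)

text \<open>
  This identity puts the derivative of the fraction in the automorphism into a form in which only the
  projection occurs.
\<close>

lemma cinner_scaleC_eq_span_proj:
  "cinner v x *\<^sub>C x = (norm x)\<^sup>2 *\<^sub>R span_proj x (v :: 'a::complex_hilbert_space)"
  by (cases "x = 0")
     (simp_all add: span_proj_def cinner_self scaleC_scaleC scaleC_algebra flip: scaleC_of_real)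

lemma ball_automorphism_0: "ball_automorphism x 0 = (x :: 'a::complex_hilbert_space)"
  using span_proj_scaleC_self[of x 1] by (simp add: ball_automorphism_def)

lemma ball_automorphism_has_derivative_0:
  fixes x :: "'a::complex_hilbert_space"
  shows "(ball_automorphism x has_derivative (\<lambda>v. - (sqrt (1 - (norm x)\<^sup>2) *\<^sub>R (v - span_proj x v)
    + (1 - (norm x)\<^sup>2) *\<^sub>R span_proj x v))) (at 0)"
proof -
  let ?P = "span_proj x" and ?s = "sqrt (1 - (norm x)\<^sup>2)"
  let ?L = "\<lambda>w. ?s *\<^sub>R (w - ?P w) + ?P w"
  interpret P: bounded_linear ?P by (rule bounded_linear_span_proj)
  have "((\<lambda>y. 1 / (1 - cinner y x)) has_derivative (\<lambda>h. cinner h x)) (at 0)"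
    by (auto intro!: derivative_eq_intros bounded_linear.has_derivative[OF bounded_linear_cinner_left])
  moreover have "((\<lambda>y. x - y) has_derivative (\<lambda>h. - h)) (at 0)"
    by (auto intro!: derivative_eq_intros)
  ultimately have "((\<lambda>y. (1 / (1 - cinner y x)) *\<^sub>C (x - y)) has_derivative
      (\<lambda>h. (1 / (1 - cinner 0 x)) *\<^sub>C (- h) + cinner h x *\<^sub>C (x - 0))) (at 0)"
    by (rule bounded_bilinear.FDERIV[OF bounded_bilinear_scaleC])
  moreover have "bounded_linear ?L"
    by (intro bounded_linear_intros bounded_linear_span_proj)
  ultimately have "((\<lambda>y. ?L ((1 / (1 - cinner y x)) *\<^sub>C (x - y))) has_derivative
      (\<lambda>h. ?L ((1 / (1 - cinner 0 x)) *\<^sub>C (- h) + cinner h x *\<^sub>C (x - 0)))) (at 0)"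
    by (rule bounded_linear.has_derivative[rotated])
  moreover have "?L ((1 / (1 - cinner 0 x)) *\<^sub>C (- h) + cinner h x *\<^sub>C (x - 0))
      = - (?s *\<^sub>R (h - ?P h) + (1 - (norm x)\<^sup>2) *\<^sub>R ?P h)" for h
  proof -
    have "?L ((1 / (1 - cinner 0 x)) *\<^sub>C (- h) + cinner h x *\<^sub>C (x - 0))
        = ?s *\<^sub>R (- h + ?P h) + (cinner h x *\<^sub>C x - ?P h)"
      by (simp add: P.diff span_proj_scaleC_self)
    then show ?thesis
      by (simp add: cinner_scaleC_eq_span_proj algebra_simps)
  qed
  ultimately show ?thesis
    by (simp add: ball_automorphism_def[abs_def] Let_def)
qed

text \<open>
  The automorphism sends the origin to \<open>x\<close>, and its derivative there multiplies \<open>x\<close> by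
  \<open>- (1 - \<parallel>x\<parallel>\<^sup>2)\<close> and the orthogonal complement of \<open>x\<close> by \<open>- sqrt (1 - \<parallel>x\<parallel>\<^sup>2)\<close>; the chain rule does the
  rest.
\<close>

lemma has_derivative_comp_ball_automorphism:
  fixes x :: "'a::complex_hilbert_space"
  assumes f: "frechet_holomorphic_on f (ball 0 1)" and x: "x \<in> ball 0 1"
  shows "((f \<circ> ball_automorphism x) has_derivative invariant_gradient f x) (at 0)"
    and "invariant_gradient f x v = - nabla f x (sqrt (1 - (norm x)\<^sup>2) *\<^sub>R (v - span_proj x v)
      + (1 - (norm x)\<^sup>2) *\<^sub>R span_proj x v)"
proof -
  interpret D: bounded_linear "nabla f x"
    using bounded_linear_nabla[OF f x] .
  let ?L = "\<lambda>v. sqrt (1 - (norm x)\<^sup>2) *\<^sub>R (v - span_proj x v) + (1 - (norm x)\<^sup>2) *\<^sub>R span_proj x v"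
  have "((f \<circ> ball_automorphism x) has_derivative (nabla f x \<circ> (\<lambda>v. - ?L v))) (at 0)"
    by (rule diff_chain_at[OF ball_automorphism_has_derivative_0])
       (use frechet_holomorphic_has_derivative[OF f x] in \<open>simp add: ball_automorphism_0\<close>)
  moreover from frechet_derivative_at[OF this]
  have eq: "invariant_gradient f x = nabla f x \<circ> (\<lambda>v. - ?L v)"
    by (simp add: invariant_gradient_def[abs_def] fun_eq_iff)
  ultimately show "((f \<circ> ball_automorphism x) has_derivative invariant_gradient f x) (at 0)"
    by simp
  show "invariant_gradient f x v = - nabla f x (?L v)"
    unfolding eq o_def by (rule D.neg)
qed

lemma bounded_linear_invariant_gradient:
  assumes "frechet_holomorphic_on f (ball 0 1)" "x \<in> ball 0 1"
  shows "bounded_linear (invariant_gradient f x)"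
  using has_derivative_comp_ball_automorphism(1)[OF assms] has_derivative_bounded_linear by blast

lemma invariant_gradient_self:
  fixes x :: "'a::complex_hilbert_space"
  assumes "frechet_holomorphic_on f (ball 0 1)" "x \<in> ball 0 1"
  shows "invariant_gradient f x x = - of_real (1 - (norm x)\<^sup>2) * radial_derivative f x"
proof -
  interpret D: bounded_linear "nabla f x"
    using bounded_linear_nabla[OF assms] .
  show ?thesis
    using span_proj_scaleC_self[of x 1]
    by (simp add: has_derivative_comp_ball_automorphism(2)[OF assms] radial_derivative_def
        D.scaleR)
       (simp add: scaleR_conv_of_real algebra_simps)
qed

lemma norm_nabla_le:
  assumes f: "frechet_holomorphic_on f (ball 0 1)" and z: "norm z < 1"
    and C: "\<And>z. norm z < 1 \<Longrightarrow> (1 - (norm z)\<^sup>2) * onorm (nabla f z) \<le> C"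
  shows "(1 - (norm z)\<^sup>2) * cmod (nabla f z v) \<le> C * norm v"
proof -
  have "bounded_linear (nabla f z)"
    using bounded_linear_nabla[OF f] z by simp
  then have "cmod (nabla f z v) \<le> onorm (nabla f z) * norm v"
    by (rule onorm)
  then have "(1 - (norm z)\<^sup>2) * cmod (nabla f z v) \<le> (1 - (norm z)\<^sup>2) * (onorm (nabla f z) * norm v)"
    using z by (intro mult_left_mono) (auto simp: abs_square_le_1)
  also have "\<dots> \<le> C * norm v"
    using mult_right_mono[OF C[OF z], of "norm v"] by (simp add: mult.assoc)
  finally show ?thesis .
qed

text \<open>
  The left-hand side is the derivative at \<open>0\<close> of \<open>K(l) = f(t x + l v) - f(s x + l v)\<close>. As \<open>v\<close> is
  orthogonal to \<open>x\<close>, the disc \<open>|l| \<le> sqrt (D / 2)\<close> keeps both points in the region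
  \<open>1 - \<parallel>z\<parallel>\<^sup>2 \<ge> D / 2\<close>, where the Bloch condition bounds the derivative of \<open>f\<close> by \<open>2 C / D\<close>. The mean
  value inequality bounds \<open>K\<close> on that disc, and Cauchy's inequality finishes. Working with
  differences of \<open>f\<close> in this way avoids mixed second derivatives.
\<close>

lemma norm_nabla_transversal_difference_le:
  fixes x v :: "'a::complex_hilbert_space"
  assumes f: "frechet_holomorphic_on f (ball 0 1)"
    and C: "\<And>z. norm z < 1 \<Longrightarrow> (1 - (norm z)\<^sup>2) * onorm (nabla f z) \<le> C"
    and v: "norm v = 1" and orth: "cinner x v = 0"
    and t: "0 \<le> s" "s < t" "t * norm x < 1" and x: "norm x \<le> 1"
  defines "D \<equiv> 1 - t\<^sup>2 * (norm x)\<^sup>2"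
  shows "cmod (nabla f (t *\<^sub>R x) v - nabla f (s *\<^sub>R x) v) \<le> 2 * C * (t - s) / (D * sqrt (D / 2))"
proof -
  have norm_disc: "(norm (q *\<^sub>R x + l *\<^sub>C v))\<^sup>2 = q\<^sup>2 * (norm x)\<^sup>2 + (cmod l)\<^sup>2" for q :: real and l
  proof -
    have "cinner (q *\<^sub>R x) (l *\<^sub>C v) = 0"
      using orth by (simp add: cinner_scaleC_right cinner_scaleC_left flip: scaleC_of_real)
    from norm_add_orthogonal[OF this] show ?thesis
      by (simp add: norm_scaleC v power_mult_distrib)
  qed
  have D: "0 < D"
  proof -
    have "(t * norm x)\<^sup>2 < 1"
      using t by (simp add: abs_square_less_1)
    then show ?thesis by (simp add: D_def power_mult_distrib)
  qed
  have in_disc: "(norm (q *\<^sub>R x + l *\<^sub>C v))\<^sup>2 \<le> 1 - D + (cmod l)\<^sup>2" if "0 \<le> q" "q \<le> t" for q l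
    unfolding norm_disc D_def using that by (simp add: mult_right_mono power_mono)
  have in_ball: "q *\<^sub>R x + l *\<^sub>C v \<in> ball 0 1" if "0 \<le> q" "q \<le> t" "cmod l < sqrt D" for q l
  proof -
    have "(cmod l)\<^sup>2 < D"
      using that(3) D by (metis norm_ge_zero power_strict_mono real_sqrt_pow2 less_imp_le zero_less_numeral)
    then have "(norm (q *\<^sub>R x + l *\<^sub>C v))\<^sup>2 < 1"
      using in_disc[OF that(1,2), of l] by linarith
    then show ?thesis by (simp add: abs_square_less_1)
  qed
  define K where "K l = f (t *\<^sub>R x + l *\<^sub>C v) - f (s *\<^sub>R x + l *\<^sub>C v)" for l
  have K: "(K has_field_derivative nabla f (t *\<^sub>R x + l *\<^sub>C v) v - nabla f (s *\<^sub>R x + l *\<^sub>C v) v) (at l)"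
    if "cmod l < sqrt D" for l
    unfolding K_def using that t
    by (intro DERIV_diff has_field_derivative_along_complex_line[OF f] in_ball) auto
  let ?r = "sqrt (D / 2)"
  have r: "?r < sqrt D" "0 < ?r" using D by auto
  have "cmod (deriv K 0) \<le> (2 * C / D * (t - s)) / ?r"
  proof (rule norm_deriv_le_Cauchy[where S = "ball 0 (sqrt D)"])
    show "K holomorphic_on ball 0 (sqrt D)"
      unfolding holomorphic_on_open[OF open_ball] using K by (metis dist_0_norm mem_ball)
    show "cball 0 ?r \<subseteq> ball (0::complex) (sqrt D)"
      using r(1) by (intro subsetI) (simp only: mem_cball mem_ball le_less_trans)
    fix l :: complex assume "l \<in> cball 0 ?r"
    then have l: "cmod l \<le> ?r" by simp
    then have l2: "(cmod l)\<^sup>2 \<le> D / 2"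
      using D by (metis norm_ge_zero power_mono real_sqrt_pow2 less_imp_le half_gt_zero)
    let ?T = "cball (0::'a) (sqrt (1 - D / 2))"
    have D1: "D \<le> 1" by (simp add: D_def)
    have "cmod (f (t *\<^sub>R x + l *\<^sub>C v) - f (s *\<^sub>R x + l *\<^sub>C v))
        \<le> 2 * C / D * norm ((t *\<^sub>R x + l *\<^sub>C v) - (s *\<^sub>R x + l *\<^sub>C v))"
    proof (rule differentiable_bound[of ?T f "nabla f"])
      have T: "(norm z)\<^sup>2 \<le> 1 - D / 2" "norm z < 1" if "z \<in> ?T" for z
      proof -
        have "norm z \<le> sqrt (1 - D / 2)" using that by simp
        from power_mono[OF this norm_ge_zero, of 2]
        show *: "(norm z)\<^sup>2 \<le> 1 - D / 2" using D1 by simp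
        have "(norm z)\<^sup>2 < 1" using * D by linarith
        then show "norm z < 1" by (simp add: abs_square_less_1)
      qed
      show "(f has_derivative nabla f z) (at z within ?T)" if "z \<in> ?T" for z
        by (rule has_derivative_at_withinI, rule frechet_holomorphic_has_derivative[OF f])
           (use T(2)[OF that] in simp)
      show "onorm (nabla f z) \<le> 2 * C / D" if "z \<in> ?T" for z
      proof -
        have "bounded_linear (nabla f z)"
          using bounded_linear_nabla[OF f] T(2)[OF that] by simp
        then have "D / 2 * onorm (nabla f z) \<le> (1 - (norm z)\<^sup>2) * onorm (nabla f z)"
          using T(1)[OF that] by (intro mult_right_mono onorm_pos_le) auto
        also have "\<dots> \<le> C" by (rule C[OF T(2)[OF that]])
        finally show ?thesis using D by (simp add: field_simps)
      qed
      show "t *\<^sub>R x + l *\<^sub>C v \<in> ?T" "s *\<^sub>R x + l *\<^sub>C v \<in> ?T"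
        using in_disc[of t l] in_disc[of s l] l2 t by (auto intro!: real_le_rsqrt)
    qed simp
    also have "(t *\<^sub>R x + l *\<^sub>C v) - (s *\<^sub>R x + l *\<^sub>C v) = (t - s) *\<^sub>R x"
      by (simp add: algebra_simps)
    also have "2 * C / D * norm ((t - s) *\<^sub>R x) \<le> 2 * C / D * (t - s)"
    proof -
      have "0 \<le> C"
        using norm_nabla_le[OF f _ C, of 0 v] v by (simp add: order_trans[OF norm_ge_zero])
      then show ?thesis
        using D t x by (intro mult_left_mono) (auto simp: mult_left_le)
    qed
    finally show "cmod (K l) \<le> 2 * C / D * (t - s)"
      by (simp add: K_def)
  qed (use r in auto)
  moreover have "deriv K 0 = nabla f (t *\<^sub>R x) v - nabla f (s *\<^sub>R x) v"
    using DERIV_imp_deriv[OF K[of 0]] D by (simp add: scaleC_algebra)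
  ultimately show ?thesis by (simp add: mult.commute mult.left_commute)
qed

text \<open>
  A Lipschitz bound with one endpoint held fixed suffices, and here the fixed endpoint is the right
  one, because the difference bound above has a constant that depends on the larger parameter only.
\<close>

lemma norm_vector_derivative_le_left:
  fixes g :: "real \<Rightarrow> 'b::real_normed_vector"
  assumes g: "(g has_vector_derivative g') (at t)" and "s0 < t"
    and B: "\<And>s. s0 < s \<Longrightarrow> s < t \<Longrightarrow> norm (g t - g s) \<le> B * (t - s)"
  shows "norm g' \<le> B"
proof (rule ccontr)
  assume "\<not> norm g' \<le> B"
  then have "0 < norm g' - B" by simp
  then obtain d where d: "d > 0"
    "\<And>s. 0 < norm (s - t) \<Longrightarrow> norm (s - t) < d \<Longrightarrow>
      norm (g s - g t - (s - t) *\<^sub>R g') / norm (s - t) < norm g' - B"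
    using g unfolding has_vector_derivative_def has_derivative_within' by blast
  define s where "s = max ((s0 + t) / 2) (t - d / 2)"
  have s: "s0 < s" "s < t" "t - s < d"
    using d(1) \<open>s0 < t\<close> by (auto simp: s_def less_max_iff_disj)
  have "norm (g s - g t - (s - t) *\<^sub>R g') / (t - s) < norm g' - B"
    using d(2)[of s] s by (simp add: norm_minus_commute)
  then have "norm (g s - g t - (s - t) *\<^sub>R g') < (norm g' - B) * (t - s)"
    using s by (simp add: divide_less_eq)
  moreover have "norm ((t - s) *\<^sub>R g') \<le> norm (g s - g t - (s - t) *\<^sub>R g') + norm (g t - g s)"
  proof -
    have "(t - s) *\<^sub>R g' = (g s - g t - (s - t) *\<^sub>R g') + (g t - g s)"
      by (simp add: algebra_simps)
    then show ?thesis by (metis norm_triangle_ineq)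
  qed
  ultimately have "(t - s) * norm g' < (norm g' - B) * (t - s) + B * (t - s)"
    using B[OF s(1,2)] s by simp
  then show False by (simp add: algebra_simps)
qed

text \<open>
  For a unit vector \<open>v\<close> and \<open>g(t) = f'(t x)(v)\<close>, the preceding difference bound gives
  \<open>|g'(t)| \<le> 2 sqrt 2 C (1 - t\<^sup>2 \<parallel>x\<parallel>\<^sup>2) powr (- 3/2)\<close>. An antiderivative of the right-hand side is
  \<open>\<phi>(t) = 2 sqrt 2 C t / sqrt (1 - t\<^sup>2 \<parallel>x\<parallel>\<^sup>2)\<close>, so that integrating from \<open>0\<close> to \<open>1\<close> loses only the
  square root of the weight. The constant is \<open>1 + 2 sqrt 2 \<le> 4\<close>.
\<close>

lemma norm_nabla_transversal_le:
  fixes x v :: "'a::complex_hilbert_space"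
  assumes f: "frechet_holomorphic_on f (ball 0 1)"
    and C: "\<And>z. norm z < 1 \<Longrightarrow> (1 - (norm z)\<^sup>2) * onorm (nabla f z) \<le> C"
    and orth: "cinner v x = 0" and x: "norm x < 1"
  shows "sqrt (1 - (norm x)\<^sup>2) * cmod (nabla f x v) \<le> 4 * C * norm v"
proof -
  define a where "a = norm x"
  have a: "0 \<le> a" "a < 1" using x by (simp_all add: a_def)
  have ball_line: "norm (t *\<^sub>R x) < 1" "0 < 1 - t\<^sup>2 * a\<^sup>2" "t * a < 1" if "0 \<le> t" "t \<le> 1" for t
  proof -
    have "t * a \<le> a" using that a by (simp add: mult_left_le_one_le)
    then show *: "t * a < 1" using a by simp
    then show "norm (t *\<^sub>R x) < 1" using that by (simp add: a_def)
    have "(t * a)\<^sup>2 < 1"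
      using * that a by (simp add: abs_square_less_1)
    then show "0 < 1 - t\<^sup>2 * a\<^sup>2" by (simp add: power_mult_distrib)
  qed
  have unit: "sqrt (1 - a\<^sup>2) * cmod (nabla f x u) \<le> 4 * C"
    if u: "norm u = 1" and "cinner u x = 0" for u
  proof -
    have xu: "cinner x u = 0"
      by (metis that(2) cinner_commute complex_cnj_zero)
    have C0: "0 \<le> C"
      using norm_nabla_le[OF f _ C, of 0 u] u by (simp add: order_trans[OF norm_ge_zero])
    define g where "g t = nabla f (t *\<^sub>R x) u" for t :: real
    define D where "D t = 1 - t\<^sup>2 * a\<^sup>2" for t
    define A where "A = (\<lambda>z. 0 + z *\<^sub>C x) -` ball 0 1"
    have "isCont (\<lambda>z. 0 + z *\<^sub>C x) z" for z
      by (rule has_derivative_continuous[OF complex_line_has_derivative])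
    then have "open A"
      unfolding A_def by (intro open_vimage) (simp_all add: continuous_at_imp_continuous_on)
    then have hol: "(\<lambda>z. nabla f (0 + z *\<^sub>C x) u) holomorphic_on A"
      by (intro nabla_holomorphic_along_complex_line[OF f]) (auto simp: A_def)
    have "\<exists>g'. (g has_vector_derivative g') (at t)" if "0 \<le> t" "t \<le> 1" for t
    proof -
      have "complex_of_real t \<in> A"
        using ball_line(1)[OF that] by (simp add: A_def scaleC_of_real)
      with hol \<open>open A\<close> obtain g' where
        "((\<lambda>z. nabla f (0 + z *\<^sub>C x) u) has_field_derivative g') (at (complex_of_real t))"
        by (auto simp: holomorphic_on_open)
      from has_vector_derivative_real_field[OF this] show ?thesis
        by (auto simp: g_def[abs_def] scaleC_of_real)
    qed
    then obtain g' where g': "\<And>t. 0 \<le> t \<Longrightarrow> t \<le> 1 \<Longrightarrow> (g has_vector_derivative g' t) (at t)"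
      by metis
    define \<phi> where "\<phi> t = 2 * sqrt 2 * C * (t / sqrt (D t))" for t
    have phi': "(\<phi> has_real_derivative 2 * C / (D t * sqrt (D t / 2))) (at t)"
      if t: "0 \<le> t" "t \<le> 1" for t
    proof -
      have D: "0 < D t" unfolding D_def by (rule ball_line(2)[OF t])
      have "(D has_real_derivative - (2 * t * a\<^sup>2)) (at t)"
        unfolding D_def by (auto intro!: derivative_eq_intros)
      from DERIV_chain2[where f = sqrt and g = D, OF DERIV_real_sqrt[OF D] this]
      have "((\<lambda>t. sqrt (D t)) has_real_derivative - (t * a\<^sup>2) / sqrt (D t)) (at t)"
        by (rule DERIV_cong) (use D in \<open>simp add: field_simps\<close>)
      then have "(\<phi> has_real_derivative 2 * sqrt 2 * C *
          ((1 * sqrt (D t) - t * (- (t * a\<^sup>2) / sqrt (D t))) / (sqrt (D t) * sqrt (D t)))) (at t)"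
        unfolding \<phi>_def using D
        by (intro DERIV_cmult[OF DERIV_divide[OF DERIV_ident]]) simp_all
      moreover have "(1 * sqrt (D t) - t * (- (t * a\<^sup>2) / sqrt (D t))) / (sqrt (D t) * sqrt (D t))
          = 1 / (D t * sqrt (D t))"
      proof -
        have "1 * sqrt (D t) - t * (- (t * a\<^sup>2) / sqrt (D t))
            = (sqrt (D t) * sqrt (D t) + t\<^sup>2 * a\<^sup>2) / sqrt (D t)"
          using D by (simp add: add_divide_distrib power2_eq_square mult.assoc real_div_sqrt)
        also have "\<dots> = 1 / sqrt (D t)"
          using D by (simp add: D_def)
        finally show ?thesis using D by simp
      qed
      moreover have "2 * sqrt 2 * C * (1 / (D t * sqrt (D t))) = 2 * C / (D t * sqrt (D t / 2))"
        by (simp add: real_sqrt_divide)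
      ultimately show ?thesis by (simp only:)
    qed
    have "norm (g 1 - g 0) \<le> \<phi> 1 - \<phi> 0"
    proof (rule differentiable_bound_general[where f' = g' and \<phi>' = "\<lambda>t. 2 * C / (D t * sqrt (D t / 2))"])
      show "continuous_on {0..1} g"
        by (intro continuous_at_imp_continuous_on ballI)
           (use g' in \<open>auto intro: has_vector_derivative_continuous\<close>)
      show "continuous_on {0..1} \<phi>"
        by (intro continuous_at_imp_continuous_on ballI)
           (use phi' in \<open>auto intro: DERIV_isCont\<close>)
      fix t :: real assume t: "0 < t" "t < 1"
      show "(g has_vector_derivative g' t) (at t)" using g' t by simp
      show "(\<phi> has_vector_derivative 2 * C / (D t * sqrt (D t / 2))) (at t)"
        using phi'[of t] t by (simp add: has_real_derivative_iff_has_vector_derivative)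
      show "norm (g' t) \<le> 2 * C / (D t * sqrt (D t / 2))"
      proof (rule norm_vector_derivative_le_left[of g "g' t" t 0])
        fix s assume s: "0 < s" "s < t"
        have "cmod (nabla f (t *\<^sub>R x) u - nabla f (s *\<^sub>R x) u)
            \<le> 2 * C * (t - s) / ((1 - t\<^sup>2 * (norm x)\<^sup>2) * sqrt ((1 - t\<^sup>2 * (norm x)\<^sup>2) / 2))"
          using s t ball_line(3)[of t] x
          by (intro norm_nabla_transversal_difference_le[OF f C u xu]) (auto simp: a_def)
        then show "norm (g t - g s) \<le> 2 * C / (D t * sqrt (D t / 2)) * (t - s)"
          by (simp add: g_def D_def a_def)
      qed (use g' t in auto)
    qed simp
    moreover have "norm (g 0) \<le> C"
      using norm_nabla_le[OF f _ C, of 0 u] u by (simp add: g_def)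
    moreover have "\<phi> 1 - \<phi> 0 = 2 * sqrt 2 * C / sqrt (1 - a\<^sup>2)"
      by (simp add: \<phi>_def D_def)
    ultimately have g1: "norm (g 1) \<le> C + 2 * sqrt 2 * C / sqrt (1 - a\<^sup>2)"
      using norm_triangle_ineq2[of "g 1" "g 0"] by linarith
    have s: "0 < sqrt (1 - a\<^sup>2)" "sqrt (1 - a\<^sup>2) \<le> 1"
      using a by (auto simp: abs_square_less_1)
    have "sqrt (1 - a\<^sup>2) * norm (g 1) \<le> sqrt (1 - a\<^sup>2) * (C + 2 * sqrt 2 * C / sqrt (1 - a\<^sup>2))"
      using g1 s by (intro mult_left_mono) auto
    also have "\<dots> = sqrt (1 - a\<^sup>2) * C + 2 * sqrt 2 * C"
      using s by (simp add: distrib_left)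
    also have "\<dots> \<le> 1 * C + 3 * C"
    proof (intro add_mono mult_right_mono)
      have "sqrt 2 \<le> 3 / 2"
        by (rule real_le_lsqrt) (simp_all add: power2_eq_square)
      then show "2 * sqrt 2 \<le> (3::real)" by simp
    qed (use s C0 in auto)
    finally show ?thesis by (simp add: g_def)
  qed
  show ?thesis
  proof (cases "v = 0")
    case True
    then show ?thesis
      using linear_0[OF bounded_linear.linear[OF bounded_linear_nabla[OF f, of x]]] x by simp
  next
    case False
    define u where "u = complex_of_real (inverse (norm v)) *\<^sub>C v"
    have "norm u = 1" "cinner u x = 0" "v = complex_of_real (norm v) *\<^sub>C u"
      using False orth
      by (simp_all add: u_def norm_scaleC norm_inverse cinner_scaleC_left scaleC_scaleC
          flip: of_real_mult)
    then have "nabla f x v = norm v * nabla f x u" "sqrt (1 - a\<^sup>2) * cmod (nabla f x u) \<le> 4 * C"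
      using nabla_scaleC[OF f, of x] x unit by (metis dist_0_norm mem_ball)+
    then show ?thesis
      using mult_right_mono[of "sqrt (1 - a\<^sup>2) * cmod (nabla f x u)" "4 * C" "norm v"]
      by (simp add: norm_mult a_def mult_ac)
  qed
qed

text \<open>
  The component along \<open>x\<close> is bounded by the Bloch condition itself, the orthogonal component by the
  transversal estimate.
\<close>

lemma invariant_gradient_bdd_above:
  fixes f :: "'a::complex_hilbert_space \<Rightarrow> complex"
  assumes "f \<in> bloch_space"
  shows "bdd_above ((\<lambda>x. onorm (invariant_gradient f x)) ` ball 0 1)"
proof -
  have f: "frechet_holomorphic_on f (ball 0 1)"
    using assms by (simp add: bloch_space_def)
  obtain C where C: "\<And>z. norm z < 1 \<Longrightarrow> (1 - (norm z)\<^sup>2) * onorm (nabla f z) \<le> C"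
    using assms unfolding bloch_space_def bdd_above_def by fastforce
  have C0: "0 \<le> C"
    using C[of 0] onorm_pos_le[OF bounded_linear_nabla[OF f, of 0]] by simp
  have "onorm (invariant_gradient f x) \<le> 5 * C" if "x \<in> ball 0 1" for x
  proof (rule onorm_bound)
    fix v
    let ?P = "span_proj x v" and ?s = "sqrt (1 - (norm x)\<^sup>2)"
    have x: "norm x < 1" using that by simp
    then have s: "0 \<le> 1 - (norm x)\<^sup>2" by (simp add: abs_square_le_1)
    interpret D: bounded_linear "nabla f x"
      using bounded_linear_nabla[OF f that] .
    have "cmod (invariant_gradient f x v) =
        cmod (nabla f x (?s *\<^sub>R (v - ?P)) + nabla f x ((1 - (norm x)\<^sup>2) *\<^sub>R ?P))"
      unfolding has_derivative_comp_ball_automorphism(2)[OF f that] D.add by (rule norm_minus_cancel)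
    also have "\<dots> \<le> ?s * cmod (nabla f x (v - ?P)) + (1 - (norm x)\<^sup>2) * cmod (nabla f x ?P)"
      using norm_triangle_ineq[of "nabla f x (?s *\<^sub>R (v - ?P))" "nabla f x ((1 - (norm x)\<^sup>2) *\<^sub>R ?P)"] s
      by (simp only: D.scaleR norm_scaleR abs_of_nonneg real_sqrt_ge_zero)
    also have "\<dots> \<le> 4 * C * norm (v - ?P) + C * norm ?P"
      by (intro add_mono norm_nabla_transversal_le[OF f C] norm_nabla_le[OF f _ C]
          cinner_minus_span_proj x)
    also have "\<dots> \<le> 4 * C * norm v + C * norm v"
      using C0 by (intro add_mono mult_left_mono norm_minus_span_proj_le norm_span_proj_le) auto
    finally show "cmod (invariant_gradient f x v) \<le> 5 * C * norm v" by simp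
  qed (use C0 in simp)
  then show ?thesis by (intro bdd_aboveI2)
qed

lemma weighted_radial_derivative_le_invariant_norm:
  fixes f :: "'a::complex_hilbert_space \<Rightarrow> complex"
  assumes "f \<in> bloch_space" and x: "norm x < 1"
  shows "(1 - (norm x)\<^sup>2) * cmod (radial_derivative f x) \<le> invariant_norm f"
proof -
  have f: "frechet_holomorphic_on f (ball 0 1)"
    using assms by (simp add: bloch_space_def)
  have xb: "x \<in> ball 0 1" using x by simp
  have bl: "bounded_linear (invariant_gradient f x)"
    by (rule bounded_linear_invariant_gradient[OF f xb])
  have "0 \<le> 1 - (norm x)\<^sup>2" using x by (simp add: abs_square_le_1)
  then have "(1 - (norm x)\<^sup>2) * cmod (radial_derivative f x) = cmod (invariant_gradient f x x)"
    unfolding invariant_gradient_self[OF f xb] by (simp only: norm_mult norm_minus_cancel norm_of_real abs_of_nonneg)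
  also have "\<dots> \<le> onorm (invariant_gradient f x) * norm x"
    by (rule onorm[OF bl])
  also have "\<dots> \<le> onorm (invariant_gradient f x)"
    using x onorm_pos_le[OF bl] by (simp add: mult_left_le)
  also have "\<dots> \<le> invariant_norm f"
    unfolding invariant_norm_def by (rule cSUP_upper[OF xb invariant_gradient_bdd_above[OF assms(1)]])
  finally show ?thesis .
qed

section \<open>Affine complex discs in the ball\<close>

text \<open>
  Take \<open>c\<close> as the point of the complex line through \<open>x\<close> and \<open>y\<close> that is nearest to the origin, and
  \<open>e\<close> as the multiple of \<open>y - x\<close> whose length is the radius of the disc that the line cuts out of the
  ball.
\<close>

lemma two_points_on_orthogonal_disc:
  fixes x y :: "'a::complex_hilbert_space"
  assumes "norm x < 1" "x \<noteq> y"
  obtains c e \<alpha> \<beta> where "cinner c e = 0" "norm c < 1" "(norm e)\<^sup>2 = 1 - (norm c)\<^sup>2"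
    "x = c + \<alpha> *\<^sub>C e" "y = c + \<beta> *\<^sub>C e"
proof
  define d where "d = y - x"
  define c where "c = x - span_proj d x"
  define R where "R = sqrt (1 - (norm c)\<^sup>2)"
  define e where "e = (complex_of_real (R / norm d)) *\<^sub>C d"
  have d: "norm d \<noteq> 0" using assms by (simp add: d_def)
  show c1: "norm c < 1"
    using norm_minus_span_proj_le[of x d] assms by (simp add: c_def)
  have R: "0 < R" using c1 by (simp add: R_def abs_square_less_1)
  show "cinner c e = 0"
    using cinner_minus_span_proj[of x d] by (simp add: c_def e_def cinner_scaleC_right)
  show "(norm e)\<^sup>2 = 1 - (norm c)\<^sup>2"
  proof -
    have "norm e = R"
      unfolding e_def norm_scaleC norm_of_real using R d by simp
    moreover have "R\<^sup>2 = 1 - (norm c)\<^sup>2"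
      using c1 by (simp add: R_def abs_square_le_1)
    ultimately show ?thesis by simp
  qed
  have de: "d = complex_of_real (norm d / R) *\<^sub>C e"
    using R d by (simp add: e_def scaleC_scaleC)
  define k where "k = cinner x d / cinner d d"
  show x: "x = c + (k * complex_of_real (norm d / R)) *\<^sub>C e"
    unfolding c_def span_proj_def k_def[symmetric] scaleC_scaleC[symmetric] de[symmetric] by simp
  have "y = x + complex_of_real (norm d / R) *\<^sub>C e"
    unfolding de[symmetric] by (simp add: d_def)
  then show "y = c + (k * complex_of_real (norm d / R) + complex_of_real (norm d / R)) *\<^sub>C e"
    unfolding scaleC_add_left using x by (simp add: add.assoc)
qed

lemma one_minus_norm_orthogonal_disc:
  fixes c e :: "'a::complex_hilbert_space"
  assumes "cinner c e = 0" "(norm e)\<^sup>2 = 1 - (norm c)\<^sup>2"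
  shows "1 - (norm (c + z *\<^sub>C e))\<^sup>2 = (1 - (norm c)\<^sup>2) * (1 - (cmod z)\<^sup>2)"
proof -
  have "cinner c (z *\<^sub>C e) = 0"
    using assms by (simp add: cinner_scaleC_right)
  from norm_add_orthogonal[OF this] show ?thesis
    by (simp add: norm_scaleC power_mult_distrib assms algebra_simps)
qed

lemma orthogonal_disc_in_ball_iff:
  fixes c e :: "'a::complex_hilbert_space"
  assumes "cinner c e = 0" "(norm e)\<^sup>2 = 1 - (norm c)\<^sup>2" "norm c < 1"
  shows "norm (c + z *\<^sub>C e) < 1 \<longleftrightarrow> cmod z < 1"
proof -
  have "0 < 1 - (norm c)\<^sup>2" using assms by (simp add: abs_square_less_1)
  then have "0 < 1 - (norm (c + z *\<^sub>C e))\<^sup>2 \<longleftrightarrow> 0 < 1 - (cmod z)\<^sup>2"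
    unfolding one_minus_norm_orthogonal_disc[OF assms(1,2)] by (simp add: zero_less_mult_iff)
  then show ?thesis by (simp add: abs_square_less_1)
qed

text \<open>
  By orthogonality each of the three factors in the definition acquires a power of \<open>1 - \<parallel>c\<parallel>\<^sup>2\<close> on the
  disc, and these powers cancel.
\<close>

lemma pseudohyperbolic_orthogonal_disc:
  fixes c e :: "'a::complex_hilbert_space"
  assumes ce: "cinner c e = 0" "(norm e)\<^sup>2 = 1 - (norm c)\<^sup>2" "norm c < 1"
    and "cmod \<alpha> < 1" "cmod \<beta> < 1"
  shows "pseudohyperbolic (c + \<alpha> *\<^sub>C e) (c + \<beta> *\<^sub>C e) = cmod ((\<alpha> - \<beta>) / (1 - cnj \<alpha> * \<beta>))"
proof -
  define R where "R = 1 - (norm c)\<^sup>2"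
  have R: "0 < R" using assms by (simp add: R_def abs_square_less_1)
  have ec: "cinner e c = 0"
    by (metis ce(1) cinner_commute complex_cnj_zero)
  have "1 - cinner (c + \<alpha> *\<^sub>C e) (c + \<beta> *\<^sub>C e) = of_real R * cnj (1 - cnj \<alpha> * \<beta>)"
    by (simp add: cinner_add_left cinner_add_right cinner_scaleC_left cinner_scaleC_right ce ec
        cinner_self R_def algebra_simps)
  then have "cmod (1 - cinner (c + \<alpha> *\<^sub>C e) (c + \<beta> *\<^sub>C e)) = R * cmod (1 - cnj \<alpha> * \<beta>)"
    using R by (simp only: norm_mult norm_of_real complex_mod_cnj abs_of_pos)
  then have "pseudohyperbolic (c + \<alpha> *\<^sub>C e) (c + \<beta> *\<^sub>C e)
      = sqrt (1 - (R * (1 - (cmod \<alpha>)\<^sup>2)) * (R * (1 - (cmod \<beta>)\<^sup>2)) / (R * cmod (1 - cnj \<alpha> * \<beta>))\<^sup>2)"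
    unfolding pseudohyperbolic_def one_minus_norm_orthogonal_disc[OF ce(1,2)] R_def by simp
  also have "\<dots> = sqrt (1 - (1 - (cmod \<alpha>)\<^sup>2) * (1 - (cmod \<beta>)\<^sup>2) / (cmod (1 - cnj \<alpha> * \<beta>))\<^sup>2)"
    using R by (simp add: power2_eq_square)
  also have "\<dots> = sqrt ((cmod ((\<alpha> - \<beta>) / (1 - cnj \<alpha> * \<beta>)))\<^sup>2)"
    unfolding one_minus_norm_disc_automorphism[OF assms(4,5), symmetric] by simp
  finally show ?thesis
    by (simp only: real_sqrt_abs abs_norm_cancel)
qed

theorem theorem3p4:
  fixes f :: "'a::complex_hilbert_space \<Rightarrow> complex" and x y :: 'a
  assumes "f \<in> bloch_space"
    and "x \<in> ball 0 1" and "y \<in> ball 0 1"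
  shows "cmod (complex_of_real (1 - (norm x)\<^sup>2) * radial_derivative f x
             - complex_of_real (1 - (norm y)\<^sup>2) * radial_derivative f y)
         \<le> 14 * invariant_norm f * pseudohyperbolic x y"
proof (cases "x = y")
  case True
  have "0 < 1 - (norm y)\<^sup>2"
    using assms by (simp add: abs_square_less_1)
  moreover have "1 - cinner y y = of_real (1 - (norm y)\<^sup>2)"
    by (simp add: cinner_self)
  ultimately have "pseudohyperbolic y y = 0"
    unfolding pseudohyperbolic_def by (simp only: norm_of_real power2_abs) (simp add: power2_eq_square)
  with True show ?thesis by simp
next
  case False
  have f: "frechet_holomorphic_on f (ball 0 1)"
    using assms by (simp add: bloch_space_def)
  have x: "norm x < 1" and y: "norm y < 1"
    using assms by simp_all
  obtain c e \<alpha> \<beta> where ce: "cinner c e = 0" "(norm e)\<^sup>2 = 1 - (norm c)\<^sup>2" "norm c < 1"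
    and xe: "x = c + \<alpha> *\<^sub>C e" and ye: "y = c + \<beta> *\<^sub>C e"
    using two_points_on_orthogonal_disc[OF x False] by metis
  have \<alpha>: "cmod \<alpha> < 1" and \<beta>: "cmod \<beta> < 1"
    using x y orthogonal_disc_in_ball_iff[OF ce] by (simp_all add: xe ye)
  define R where "R = 1 - (norm c)\<^sup>2"
  have R: "0 < R" using ce by (simp add: R_def abs_square_less_1)
  \<comment> \<open>The constant factor \<open>R\<close> turns the weight of the ball into the weight of the unit disc.\<close>
  define H where "H z = of_real R * radial_derivative f (c + z *\<^sub>C e)" for z
  have weight: "of_real (1 - (norm (c + z *\<^sub>C e))\<^sup>2) * radial_derivative f (c + z *\<^sub>C e)
      = of_real (1 - (cmod z)\<^sup>2) * H z" for z
    unfolding one_minus_norm_orthogonal_disc[OF ce(1,2)] H_def R_def by simp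
  have "cmod (of_real (1 - (cmod \<alpha>)\<^sup>2) * H \<alpha> - of_real (1 - (cmod \<beta>)\<^sup>2) * H \<beta>)
      \<le> 14 * invariant_norm f * cmod ((\<alpha> - \<beta>) / (1 - cnj \<alpha> * \<beta>))"
  proof (rule weighted_difference_le_disc_distance[OF _ _ \<alpha> \<beta>])
    have line: "c + z *\<^sub>C e \<in> ball 0 1" if "z \<in> ball 0 1" for z
      using that orthogonal_disc_in_ball_iff[OF ce] by simp
    have "(\<lambda>z. of_real R * (nabla f (c + z *\<^sub>C e) c + z * nabla f (c + z *\<^sub>C e) e)) holomorphic_on ball 0 1"
      by (intro holomorphic_intros nabla_holomorphic_along_complex_line[OF f _ _ line]) auto
    moreover have "H z = of_real R * (nabla f (c + z *\<^sub>C e) c + z * nabla f (c + z *\<^sub>C e) e)"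
      if "z \<in> ball 0 1" for z
      using linear_add[OF bounded_linear.linear[OF bounded_linear_nabla[OF f line[OF that]]]]
      by (simp add: H_def radial_derivative_def nabla_scaleC[OF f line[OF that]])
    ultimately show "H holomorphic_on ball 0 1"
      using holomorphic_cong by (metis (no_types, lifting))
    show "(1 - (cmod z)\<^sup>2) * cmod (H z) \<le> invariant_norm f" if "cmod z < 1" for z
    proof -
      have "norm (c + z *\<^sub>C e) < 1" using that orthogonal_disc_in_ball_iff[OF ce] by simp
      from weighted_radial_derivative_le_invariant_norm[OF assms(1) this]
      show ?thesis
        unfolding one_minus_norm_orthogonal_disc[OF ce(1,2)] H_def R_def[symmetric]
        using R by (simp add: norm_mult mult_ac)
    qed
  qed
  then show ?thesis
    unfolding xe ye weight pseudohyperbolic_orthogonal_disc[OF ce \<alpha> \<beta>] .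
qed

end
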